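(* There exists a locally countable $T_2$ D-space $X$ of cardinality $\omega_1$ which does not satisfy the following property $( * )$: for every regular uncountable cardinal $\kappa$ and every $A\subseteq X$ with $|A|=\kappa$, either $A$ has a complete accumulation point in $X$, or $A$ has a subset of size $\kappa$ which is closed discrete in $X$.
   Context: A space is locally countable if every point has a countable neighborhood. A subset of a space is closed discrete if it is closed and discrete in the subspace topology. A point $x\in X$ is a complete accumulation point of $A$ if $|U\cap A|=|A|$ for every neighborhood $U$ of $x$. An open neighborhood assignment (ONA) on $(X,\tau)$ is a map $U:X\to\tau$ with $x\in U(x)$ for all $x\in X$. $X$ is a D-space if for every ONA $U$ there is a closed discrete $D\subseteq X$ with $X=\bigcup_{d\in D}U(d)$. *)

theory Defs
  imports "HOL-Analysis.Analysis"
begin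

unbundle cardinal_syntax

definition neighborhood_of :: "'a topology \<Rightarrow> 'a \<Rightarrow> 'a set \<Rightarrow> bool" where
  "neighborhood_of X x N \<longleftrightarrow> N \<subseteq> topspace X \<and> (\<exists>U. openin X U \<and> x \<in> U \<and> U \<subseteq> N)"

definition locally_countable :: "'a topology \<Rightarrow> bool" where
  "locally_countable X \<longleftrightarrow> (\<forall>x\<in>topspace X. \<exists>N. neighborhood_of X x N \<and> countable N)"

definition closed_discrete :: "'a topology \<Rightarrow> 'a set \<Rightarrow> bool" where
  "closed_discrete X D \<longleftrightarrow> closedin X D \<and> subtopology X D = discrete_topology D"

definition complete_accumulation_point :: "'a topology \<Rightarrow> 'a set \<Rightarrow> 'a \<Rightarrow> bool" where
  "complete_accumulation_point X A x \<longleftrightarrow>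
     x \<in> topspace X \<and> (\<forall>N. neighborhood_of X x N \<longrightarrow> |N \<inter> A| =o |A| )"

definition open_neighborhood_assignment :: "'a topology \<Rightarrow> ('a \<Rightarrow> 'a set) \<Rightarrow> bool" where
  "open_neighborhood_assignment X U \<longleftrightarrow> (\<forall>x\<in>topspace X. openin X (U x) \<and> x \<in> U x)"

definition D_space :: "'a topology \<Rightarrow> bool" where
  "D_space X \<longleftrightarrow>
     (\<forall>U. open_neighborhood_assignment X U \<longrightarrow>
        (\<exists>D. closed_discrete X D \<and> topspace X = (\<Union>d\<in>D. U d)))"

text \<open>Cardinals are represented, up to order isomorphism, by well-orders satisfying
  \<^const>\<open>Card_order\<close>. In \<open>property_star\<close>, letting \<open>\<kappa>\<close> range over such relations on the point type \<open>'a\<close>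
  loses nothing: a cardinal with \<open>|A| = \<kappa>\<close> for some \<open>A\<close> of type \<open>'a set\<close> is isomorphic to one
  living on \<open>'a\<close>. For infinite cardinals, \<^const>\<open>regularCard\<close> is the usual regularity.\<close>

definition property_star :: "'a topology \<Rightarrow> bool" where
  "property_star X \<longleftrightarrow>
     (\<forall>(\<kappa> :: 'a rel) A.
        Card_order \<kappa> \<and> regularCard \<kappa> \<and> natLeq <o \<kappa> \<and> A \<subseteq> topspace X \<and> |A| =o \<kappa> \<longrightarrow>
          (\<exists>x. complete_accumulation_point X A x) \<or>
          (\<exists>B\<subseteq>A. |B| =o \<kappa> \<and> closed_discrete X B))"

end

theory Submission
  imports Defs "HOL-Library.Countable_Set_Type"
begin

text \<open>The space is \<open>\<omega>\<^sub>1\<close> with the order topology refined by forgetting, in every neighbourhood of a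
  limit ordinal, all the other limit ordinals. A superset of the closed discrete set of limit
  ordinals is closed, and given an assignment \<open>U\<close>, adding to the limit ordinals the (isolated) points
  missed by \<open>U\<close> on the limit ordinals gives the required \<open>D\<close>. The set \<open>A\<close> of non-limits violates
  \<^const>\<open>property_star\<close>: the least \<open>a\<close> with infinitely many elements of \<open>B \<subseteq> A\<close> below it is an
  accumulation point of \<open>B\<close> and a limit, hence not in \<open>B\<close>; and local countability excludes complete
  accumulation points.\<close>

section \<open>Well-orders of type \<open>\<omega>\<^sub>1\<close>\<close>

locale omega1_order =
  fixes r :: "'a rel"
  assumes well_order: "Well_order r"
    and countable_underS: "x \<in> Field r \<Longrightarrow> countable (underS r x)"
    and uncountable_Field: "uncountable (Field r)"
begin

abbreviation less :: "'a \<Rightarrow> 'a \<Rightarrow> bool" (infix "\<sqsubset>" 50)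
  where "x \<sqsubset> y \<equiv> x \<in> underS r y"

lemma less_Field: "x \<sqsubset> y \<Longrightarrow> x \<in> Field r" "x \<sqsubset> y \<Longrightarrow> y \<in> Field r"
  by (auto simp: underS_def Field_def)

lemma less_irrefl: "\<not> x \<sqsubset> x"
  by (simp add: underS_def)

lemma less_trans: "x \<sqsubset> y \<Longrightarrow> y \<sqsubset> z \<Longrightarrow> x \<sqsubset> z"
  using well_order
  unfolding underS_def well_order_on_def linear_order_on_def partial_order_on_def preorder_on_def
    trans_def antisym_def
  by blast

lemma less_linear: "x \<in> Field r \<Longrightarrow> y \<in> Field r \<Longrightarrow> x \<sqsubset> y \<or> x = y \<or> y \<sqsubset> x"
  using well_order
  unfolding underS_def well_order_on_def linear_order_on_def total_on_def
  by blast

lemma ex_least: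
  assumes "x \<in> Field r" "P x"
  obtains m where "m \<in> Field r" "P m" "\<And>y. y \<sqsubset> m \<Longrightarrow> \<not> P y"
proof -
  have "wf (r - Id)"
    using well_order by (simp add: well_order_on_def)
  then obtain m where "m \<in> {x \<in> Field r. P x}" "\<And>y. (y, m) \<in> r - Id \<Longrightarrow> y \<notin> {x \<in> Field r. P x}"
    using assms by (elim wfE_min[of _ x "{x \<in> Field r. P x}"]) auto
  with that show thesis
    by (auto simp: underS_def Field_def)
qed

text \<open>Regularity of \<open>\<omega>\<^sub>1\<close>: the initial segments up to the elements
  of \<open>C\<close> have a countable union, so some point lies outside it, and by linearity this
  point is above all of \<open>C\<close>.\<close>

lemma countable_bounded:
  assumes "countable C" "C \<subseteq> Field r"
  obtains x where "x \<in> Field r" "\<And>c. c \<in> C \<Longrightarrow> c \<sqsubset> x"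
proof -
  have "countable (\<Union>c\<in>C. insert c (underS r c))"
    using assms countable_underS by blast
  then obtain x where "x \<in> Field r" "x \<notin> (\<Union>c\<in>C. insert c (underS r c))"
    using uncountable_Field by (meson countable_subset subsetI)
  then show thesis
    using that less_linear assms(2) by blast
qed

section \<open>Limit points and uncountable sets\<close>

definition limits :: "'a set" where
  "limits = {a. (\<exists>b. b \<sqsubset> a) \<and> (\<forall>b. b \<sqsubset> a \<longrightarrow> (\<exists>c. b \<sqsubset> c \<and> c \<sqsubset> a))}"

lemma limits_Field: "limits \<subseteq> Field r"
  using less_Field by (auto simp: limits_def)

lemma uncountable_nonlimits: "uncountable (Field r - limits)"
proof
  assume "countable (Field r - limits)"
  then obtain x where x: "x \<in> Field r" "\<And>c. c \<in> Field r - limits \<Longrightarrow> c \<sqsubset> x"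
    by (rule countable_bounded) auto
  obtain y where "x \<sqsubset> y"
    using x(1) countable_bounded[of "{x}"] by auto
  \<comment> \<open>The immediate successor \<open>m\<close> of the alleged bound \<open>x\<close>
    is a non-limit, since nothing lies strictly between \<open>x\<close> and
    \<open>m\<close>.\<close>
  then obtain m where m: "x \<sqsubset> m" "\<And>y. y \<sqsubset> m \<Longrightarrow> \<not> x \<sqsubset> y"
    using ex_least[of y "\<lambda>y. x \<sqsubset> y"] less_Field(2) by metis
  then have "m \<in> Field r - limits"
    using less_Field(2) unfolding limits_def by blast
  then show False
    using x(2) less_trans[OF m(1), of x] less_irrefl by blast
qed

lemma uncountable_accumulates:
  assumes "B \<subseteq> Field r" "uncountable B"
  obtains a where "a \<in> limits" "\<And>b. b \<sqsubset> a \<Longrightarrow> \<exists>c\<in>B. b \<sqsubset> c \<and> c \<sqsubset> a"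
proof -
  \<comment> \<open>Passing to a countably infinite subset makes \<open>countable_bounded\<close>
    applicable, which yields a point with infinitely many elements of \<open>B\<close> below
    it.\<close>
  obtain C where C: "C \<subseteq> B" "countable C" "infinite C"
    using assms(2) infinite_countable_subset' uncountable_infinite by metis
  obtain x where "x \<in> Field r" "\<And>c. c \<in> C \<Longrightarrow> c \<sqsubset> x"
    using countable_bounded C assms(1) by (metis subset_trans)
  moreover from this have "C \<subseteq> B \<inter> underS r x"
    using C(1) by blast
  then have "infinite (B \<inter> underS r x)"
    using C(3) infinite_super by metis
  ultimately obtain a where a: "a \<in> Field r" "infinite (B \<inter> underS r a)"
    and least: "\<And>y. y \<sqsubset> a \<Longrightarrow> finite (B \<inter> underS r y)"
    using ex_least[of x "\<lambda>x. infinite (B \<inter> underS r x)"] by metis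
  have between: "\<exists>c\<in>B. b \<sqsubset> c \<and> c \<sqsubset> a" if "b \<sqsubset> a" for b
  proof -
    \<comment> \<open>By minimality of \<open>a\<close> only finitely many elements of
      \<open>B\<close> lie below \<open>b\<close>; adding \<open>b\<close> itself keeps the set
      finite and makes the element found strictly larger than \<open>b\<close>.\<close>
    have "\<not> B \<inter> underS r a \<subseteq> insert b (B \<inter> underS r b)"
      using least[OF that] a(2) by (meson finite.insertI finite_subset)
    then obtain c where "c \<in> B" "c \<sqsubset> a" "c \<noteq> b" "\<not> c \<sqsubset> b"
      by blast
    then show ?thesis
      using less_linear[of b c] less_Field that by blast
  qed
  moreover have "underS r a \<noteq> {}"
    using a(2) by auto
  ultimately have "a \<in> limits"
    unfolding limits_def by blast
  then show thesis
    using that between by blast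
qed

section \<open>The thinned order topology\<close>

definition thin_open :: "'a set \<Rightarrow> bool" where
  "thin_open U \<longleftrightarrow> U \<subseteq> Field r \<and>
     (\<forall>a\<in>U \<inter> limits. \<exists>b. b \<sqsubset> a \<and> (\<forall>c. b \<sqsubset> c \<and> c \<sqsubset> a \<and> c \<notin> limits \<longrightarrow> c \<in> U))"

definition thin_topology :: "'a topology" where
  "thin_topology = topology thin_open"

lemma istopology_thin_open: "istopology thin_open"
  unfolding istopology_def
proof (intro conjI allI impI)
  fix S T assume S: "thin_open S" and T: "thin_open T"
  show "thin_open (S \<inter> T)"
    unfolding thin_open_def
  proof (intro conjI ballI)
    show "S \<inter> T \<subseteq> Field r"
      using S by (auto simp: thin_open_def)
    fix a assume a: "a \<in> S \<inter> T \<inter> limits"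
    obtain b where b: "b \<sqsubset> a" "\<And>c. b \<sqsubset> c \<Longrightarrow> c \<sqsubset> a \<Longrightarrow> c \<notin> limits \<Longrightarrow> c \<in> S"
      using S a unfolding thin_open_def by blast
    obtain b' where b': "b' \<sqsubset> a" "\<And>c. b' \<sqsubset> c \<Longrightarrow> c \<sqsubset> a \<Longrightarrow> c \<notin> limits \<Longrightarrow> c \<in> T"
      using T a unfolding thin_open_def by blast
    \<comment> \<open>The larger of \<open>b\<close> and \<open>b'\<close> serves as
      \<open>m\<close>.\<close>
    obtain m where "m \<sqsubset> a" "\<And>c. m \<sqsubset> c \<Longrightarrow> b \<sqsubset> c \<and> b' \<sqsubset> c"
      using less_linear[OF less_Field(1)[OF b(1)] less_Field(1)[OF b'(1)]] b(1) b'(1) less_trans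
      by metis
    then show "\<exists>b. b \<sqsubset> a \<and> (\<forall>c. b \<sqsubset> c \<and> c \<sqsubset> a \<and> c \<notin> limits \<longrightarrow> c \<in> S \<inter> T)"
      using b(2) b'(2) by (intro exI[of _ m]) simp
  qed
next
  fix \<K> assume \<K>: "\<forall>K\<in>\<K>. thin_open K"
  show "thin_open (\<Union>\<K>)"
    unfolding thin_open_def
  proof (intro conjI ballI)
    show "\<Union>\<K> \<subseteq> Field r"
      using \<K> by (auto simp: thin_open_def)
    fix a assume "a \<in> \<Union>\<K> \<inter> limits"
    then obtain K where K: "K \<in> \<K>" "a \<in> K \<inter> limits"
      by blast
    then obtain b where "b \<sqsubset> a" "\<forall>c. b \<sqsubset> c \<and> c \<sqsubset> a \<and> c \<notin> limits \<longrightarrow> c \<in> K"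
      using \<K> unfolding thin_open_def by meson
    then show "\<exists>b. b \<sqsubset> a \<and> (\<forall>c. b \<sqsubset> c \<and> c \<sqsubset> a \<and> c \<notin> limits \<longrightarrow> c \<in> \<Union>\<K>)"
      using K(1) by (intro exI[of _ b]) auto
  qed
qed

lemma openin_thin: "openin thin_topology U \<longleftrightarrow> thin_open U"
  by (simp add: thin_topology_def topology_inverse' istopology_thin_open)

lemma topspace_thin: "topspace thin_topology = Field r"
proof -
  have "thin_open (Field r)"
    using less_Field by (auto simp: thin_open_def limits_def)
  then show ?thesis
    by (metis openin_thin openin_subset openin_topspace subset_antisym thin_open_def)
qed

text \<open>Openness imposes a condition only at limit points, so every non-limit is isolated and
  every set containing \<open>limits\<close> has an open complement.\<close>

lemma thin_open_nonlimits: "U \<subseteq> Field r - limits \<Longrightarrow> thin_open U"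
  by (auto simp: thin_open_def)

lemma thin_open_atMost: "x \<in> Field r \<Longrightarrow> thin_open (insert x (underS r x))"
  using less_trans less_Field unfolding thin_open_def limits_def by blast

lemma thin_open_greaterThan: "thin_open {y. x \<sqsubset> y}"
  using less_Field by (auto simp: thin_open_def)

section \<open>Local countability, separation and the D-property\<close>

lemma countable_neighborhood:
  assumes "x \<in> Field r"
  shows "neighborhood_of thin_topology x (insert x (underS r x))"
    and "countable (insert x (underS r x))"
  using assms thin_open_atMost[OF assms] less_Field countable_underS
  by (auto simp: neighborhood_of_def topspace_thin openin_thin)

lemma locally_countable_thin: "locally_countable thin_topology"
  using countable_neighborhood by (auto simp: locally_countable_def topspace_thin)

text \<open>The initial segment up to the smaller of two points and the final segment beyond it are
  open and disjoint, and the larger point lies in the latter.\<close>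

lemma Hausdorff_thin: "Hausdorff_space thin_topology"
proof -
  have sep: "disjnt (insert x (underS r x)) {z. x \<sqsubset> z}" for x
    using less_trans less_irrefl by (auto simp: disjnt_def)
  show ?thesis
    unfolding Hausdorff_space_def topspace_thin openin_thin
  proof (intro allI impI)
    fix x y assume xy: "x \<in> Field r \<and> y \<in> Field r \<and> x \<noteq> y"
    then consider "x \<sqsubset> y" | "y \<sqsubset> x"
      using less_linear by blast
    then show "\<exists>U V. thin_open U \<and> thin_open V \<and> x \<in> U \<and> y \<in> V \<and> disjnt U V"
    proof cases
      case 1
      then show ?thesis
        using xy sep[of x] thin_open_atMost[of x] thin_open_greaterThan[of x] by blast
    next
      case 2
      then show ?thesis
        using xy sep[of y] thin_open_atMost[of y] thin_open_greaterThan[of y]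
        by (metis disjnt_sym insertI1 mem_Collect_eq)
    qed
  qed
qed

lemma D_space_thin: "D_space thin_topology"
  unfolding D_space_def
proof (intro allI impI)
  fix U assume "open_neighborhood_assignment thin_topology U"
  then have U: "thin_open (U x)" "x \<in> U x" if "x \<in> Field r" for x
    using that by (auto simp: open_neighborhood_assignment_def topspace_thin openin_thin)
  define D where "D = limits \<union> (Field r - (\<Union>d\<in>limits. U d))"
  have D_Field: "D \<subseteq> Field r"
    using limits_Field by (auto simp: D_def)
  have closed: "closedin thin_topology D"
    using D_Field thin_open_nonlimits[of "Field r - D"]
    by (auto simp: closedin_def topspace_thin openin_thin D_def)
  have "openin (subtopology thin_topology D) S" if "S \<subseteq> D" for S
  proof -
    \<comment> \<open>The trace of this set on \<open>D\<close> is \<open>S\<close>, so its openness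
      makes \<open>S\<close> relatively open.\<close>
    have "thin_open (S \<union> (Field r - D))"
      unfolding thin_open_def
    proof (intro conjI ballI)
      show "S \<union> (Field r - D) \<subseteq> Field r"
        using that D_Field by blast
      fix a assume "a \<in> (S \<union> (Field r - D)) \<inter> limits"
      then have a: "a \<in> limits"
        by blast
      \<comment> \<open>Non-limits in \<open>U a\<close> are covered from \<open>limits\<close>,
        hence lie outside \<open>D\<close>; the bound \<open>b\<close> for \<open>U a\<close>
        therefore works here too.\<close>
      then obtain b where "b \<sqsubset> a" "\<And>c. b \<sqsubset> c \<Longrightarrow> c \<sqsubset> a \<Longrightarrow> c \<notin> limits \<Longrightarrow> c \<in> U a"
        using U[of a] limits_Field unfolding thin_open_def by blast
      then show "\<exists>b. b \<sqsubset> a \<and>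
          (\<forall>c. b \<sqsubset> c \<and> c \<sqsubset> a \<and> c \<notin> limits \<longrightarrow> c \<in> S \<union> (Field r - D))"
        using a less_Field unfolding D_def by blast
    qed
    moreover have "S = (S \<union> (Field r - D)) \<inter> D"
      using that by blast
    ultimately show ?thesis
      unfolding openin_subtopology openin_thin by blast
  qed
  then have "subtopology thin_topology D = discrete_topology D"
    using D_Field openin_subset[of "subtopology thin_topology D"]
    by (auto simp: topology_eq topspace_subtopology topspace_thin)
  moreover have "Field r = (\<Union>d\<in>D. U d)"
  proof
    show "Field r \<subseteq> (\<Union>d\<in>D. U d)"
      using U(2) by (auto simp: D_def)
    show "(\<Union>d\<in>D. U d) \<subseteq> Field r"
      using U(1) D_Field unfolding thin_open_def by blast
  qed
  ultimately show "\<exists>D. closed_discrete thin_topology D \<and> topspace thin_topology = (\<Union>d\<in>D. U d)"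
    using closed by (auto simp: closed_discrete_def topspace_thin)
qed

text \<open>If \<open>B\<close> were uncountable, it would accumulate at a limit \<open>a\<close>.
  As \<open>a\<close> is outside \<open>B\<close>, the open complement of \<open>B\<close> would
  contain all non-limits between some \<open>b\<close> and \<open>a\<close>, among them an element
  of \<open>B\<close>.\<close>

lemma closedin_nonlimits_countable:
  assumes "B \<subseteq> Field r - limits" "closedin thin_topology B"
  shows "countable B"
proof (rule ccontr)
  assume "uncountable B"
  then obtain a where a: "a \<in> limits" "\<And>b. b \<sqsubset> a \<Longrightarrow> \<exists>c\<in>B. b \<sqsubset> c \<and> c \<sqsubset> a"
    using uncountable_accumulates[of B] assms(1) by (metis Diff_subset subset_trans)
  have "thin_open (Field r - B)"
    using assms(2) by (simp add: closedin_def topspace_thin openin_thin)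
  moreover have "a \<in> Field r - B"
    using a(1) assms(1) limits_Field by blast
  ultimately obtain b where "b \<sqsubset> a"
    "\<And>c. b \<sqsubset> c \<Longrightarrow> c \<sqsubset> a \<Longrightarrow> c \<notin> limits \<Longrightarrow> c \<in> Field r - B"
    using a(1) unfolding thin_open_def by blast
  then show False
    using a(2) assms(1) by blast
qed

end

section \<open>Cardinality \<open>\<omega>\<^sub>1\<close> and its well-order\<close>

lemma ordIso_countable_iff: "|A| =o |B| \<Longrightarrow> countable A \<longleftrightarrow> countable B"
  by (meson countable_card_le_natLeq ordIso_ordLeq_trans ordIso_symmetric)

lemma uncountable_iff_cardSuc_le: "uncountable A \<longleftrightarrow> cardSuc natLeq \<le>o |A|"
  by (simp add: countable_card_le_natLeq
      cardSuc_ordLess_ordLeq[OF natLeq_Card_order card_of_Card_order]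
      not_ordLeq_iff_ordLess[OF natLeq_Well_order card_of_Well_order])

text \<open>Translates between the countability statements of the locale and the cardinal equations
  of the theorem: no cardinal lies strictly between \<open>natLeq\<close> and its successor.\<close>

lemma uncountable_ordIso_cardSuc:
  "uncountable A \<longleftrightarrow> |A| =o cardSuc natLeq" if "A \<subseteq> Field (cardSuc natLeq)"
proof -
  have "|A| \<le>o |Field (cardSuc natLeq)|"
    using that by (rule card_of_mono1)
  then have "|A| \<le>o cardSuc natLeq"
    using card_of_Field_ordIso[OF cardSuc_Card_order[OF natLeq_Card_order]]
    by (rule ordLeq_ordIso_trans)
  then show ?thesis
    by (simp add: uncountable_iff_cardSuc_le ordIso_iff_ordLeq)
qed

text \<open>\<open>cardSuc\<close> turns a relation on \<open>nat\<close> into one on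
  \<open>nat set\<close>, which fixes the type of the points. Proper initial segments are smaller
  than the successor cardinal, hence countable.\<close>

interpretation omega1: omega1_order "cardSuc natLeq"
proof
  have card: "Card_order (cardSuc natLeq)"
    by (simp add: cardSuc_Card_order natLeq_Card_order)
  then show "Well_order (cardSuc natLeq)"
    by (simp add: card_order_on_well_order_on)
  show "countable (underS (cardSuc natLeq) x)" if "x \<in> Field (cardSuc natLeq)" for x
    using card_of_underS[OF card that]
    by (simp add: countable_card_le_natLeq cardSuc_ordLeq_ordLess natLeq_Card_order card_of_Card_order)
  show "uncountable (Field (cardSuc natLeq))"
    using uncountable_ordIso_cardSuc[OF subset_refl] card_of_Field_ordIso[OF card] by simp
qed

theorem proposition3p2:
  shows "\<exists>X :: nat set topology.
    |topspace X| =o cardSuc natLeq \<and>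
    locally_countable X \<and> Hausdorff_space X \<and> D_space X \<and> \<not> property_star X"
proof (intro exI conjI)
  let ?X = omega1.thin_topology and ?\<kappa> = "cardSuc natLeq"
  let ?A = "Field ?\<kappa> - omega1.limits"
  show "|topspace ?X| =o ?\<kappa>"
    using omega1.uncountable_Field uncountable_ordIso_cardSuc[OF subset_refl]
    by (simp add: omega1.topspace_thin)
  show "locally_countable ?X" "Hausdorff_space ?X" "D_space ?X"
    by (fact omega1.locally_countable_thin omega1.Hausdorff_thin omega1.D_space_thin)+
  have "Card_order ?\<kappa>" "regularCard ?\<kappa>" "natLeq <o ?\<kappa>"
    by (simp_all add: cardSuc_Card_order regularCard_cardSuc cardSuc_greater natLeq_Card_order
        natLeq_Cinfinite)
  moreover have "|?A| =o ?\<kappa>"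
    using omega1.uncountable_nonlimits uncountable_ordIso_cardSuc[OF Diff_subset] by simp
  moreover have "\<not> complete_accumulation_point ?X ?A x" for x
  proof
    assume acc: "complete_accumulation_point ?X ?A x"
    then have x: "x \<in> Field ?\<kappa>"
      by (simp add: complete_accumulation_point_def omega1.topspace_thin)
    let ?N = "insert x (underS ?\<kappa> x)"
    \<comment> \<open>Impossible, because \<open>?N\<close> is a countable neighbourhood while
      \<open>?A\<close> is uncountable.\<close>
    have "|?N \<inter> ?A| =o |?A|"
      using acc omega1.countable_neighborhood(1)[OF x] by (simp add: complete_accumulation_point_def)
    then show False
      using ordIso_countable_iff omega1.uncountable_nonlimits omega1.countable_neighborhood(2)[OF x]
      by (meson countable_Int1)
  qed
  moreover have "\<not> |B| =o ?\<kappa>" if "B \<subseteq> ?A" "closed_discrete ?X B" for B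
    using omega1.closedin_nonlimits_countable[OF that(1)] that uncountable_ordIso_cardSuc[of B]
    by (auto simp: closed_discrete_def)
  ultimately show "\<not> property_star ?X"
    unfolding property_star_def omega1.topspace_thin by (meson Diff_subset)
qed

end
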